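(* The e.m.t.-fication functor $\mathsf{emt}:\mathbf{PreExt\Psi MetTop}\to\mathbf{ExtMetTop}$ is left adjoint to the inclusion functor $\iota:\mathbf{ExtMetTop}\hookrightarrow\mathbf{PreExt\Psi MetTop}$. In particular, $\mathbf{ExtMetTop}$ is a reflective subcategory of $\mathbf{PreExt\Psi MetTop}$, with reflector $\mathsf{emt}$. Moreover, the assignment that sends each object $(X,\tau,d)$ of $\mathbf{PreExt\Psi MetTop}$ to the map $\mathsf{c}_{(X,\tau,d)}$, regarded as a morphism $(X,\tau,d)\to(\iota\circ\mathsf{emt})((X,\tau,d))$ in $\mathbf{PreExt\Psi MetTop}$, is a natural transformation from the identity functor of $\mathbf{PreExt\Psi MetTop}$ to the functor $\iota\circ\mathsf{emt}$.
   Context: An extended pseudodistance on a set $X$ is a function $d:X\times X\to[0,+\infty]$ with $d(x,x)=0$, symmetric and satisfying the triangle inequality; it is an extended distance if moreover $d(x,y)=0$ implies $x=y$. A pre-e.pm.t. space is a triple $(X,\tau,d)$ with $\tau$ a topology and $d$ an extended pseudodistance on $X$ (no compatibility required). A continuous-short map $(X,\tau_X,d_X)\to(Y,\tau_Y,d_Y)$ is a map that is continuous for $\tau_X,\tau_Y$ and satisfies $d_Y(\varphi(x),\varphi(y))\le d_X(x,y)$ for all $x,y$. $\mathrm{LIP}_{b,1}(X,\tau,d)$ is the set of bounded $\tau$-continuous $f:X\to\mathbb{R}$ with $|f(x)-f(y)|\le d(x,y)$ for all $x,y$. An e.m.t. space is a pre-e.pm.t. space $(X,\tau,d)$ such that $d$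 is an extended distance, $\tau$ is the initial topology of $\mathrm{LIP}_{b,1}(X,\tau,d)$, and $d(x,y)=\sup\{|f(x)-f(y)|:f\in\mathrm{LIP}_{b,1}(X,\tau,d)\}$ for all $x,y\in X$. $\mathbf{PreExt\Psi MetTop}$ is the category of pre-e.pm.t. spaces and continuous-short maps; $\mathbf{ExtMetTop}$ is its full subcategory of e.m.t. spaces. The e.m.t.-fication of a pre-e.pm.t. space $(X,\tau,d)$ is the e.m.t. space $\mathsf{emt}((X,\tau,d))=(\check X,\check\tau,\check d)$ together with the continuous-short map $\mathsf{c}_{(X,\tau,d)}:X\to\check X$ defined as follows: let $\tilde d(x,y)=\sup\{|f(x)-f(y)|:f\in\mathrm{LIP}_{b,1}(X,\tau,d)\}$; $\check X$ is the quotient of $X$ by the relation $\tilde d(x,y)=0$, $\mathsf{c}_{(X,\tau,d)}$ is the quotient map, $\check d(\mathsf{c}(x),\mathsf{c}(y))=\tilde d(x,y)$, and $\check\tau$ is the initial topology of $\mathrm{LIP}_{b,1}(\check X,\tilde\tau,\check d)$, where $\tilde\tau$ is the quotient topology of $\tau$ on $\check X$. On a morphism $\varphi:(X,\tau_X,d_X)\to(Y,\tau_Y,d_Y)$, $\mathsf{emt}(\varphi)=\check\varphi:(\check X,\check\tau_X,\check d_X)\to(\check Y,\check\tau_Y,\check d_Y)$ is the unique continuous-short map with $\check\varphi\circ\mathsf{c}_{(X,\tau_X,d_X)}=\mathsf{c}_{(Y,\tau_Y,d_Y)}\circ\varphi$. A fully faithful functor $F:\mathbf{A}\to\mathbf{B}$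 having a left adjoint $G$ is said to exhibit $\mathbf{A}$ as a reflective subcategory of $\mathbf{B}$, with reflector $G$. *)

theory Defs
  imports "HOL-Analysis.Analysis"
begin

section \<open>Categories, functors, natural transformations, adjunctions\<close>

text \<open>
  A category is given by its objects and a family of hom-sets. The hom-sets need not be
  disjoint, so composition takes the three objects as arguments: \<open>Cmp C X Y Z g f\<close> is the
  composite of \<open>f : X \<rightarrow> Y\<close> and \<open>g : Y \<rightarrow> Z\<close>. Likewise the action of a functor on morphisms
  takes source and target as arguments.
\<close>

record ('o, 'm) cat =
  Obj :: "'o set"
  Hom :: "'o \<Rightarrow> 'o \<Rightarrow> 'm set"
  Idn :: "'o \<Rightarrow> 'm"
  Cmp :: "'o \<Rightarrow> 'o \<Rightarrow> 'o \<Rightarrow> 'm \<Rightarrow> 'm \<Rightarrow> 'm"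

definition category :: "('o, 'm) cat \<Rightarrow> bool" where
  "category C \<longleftrightarrow>
     (\<forall>X\<in>Obj C. Idn C X \<in> Hom C X X) \<and>
     (\<forall>X\<in>Obj C. \<forall>Y\<in>Obj C. \<forall>Z\<in>Obj C. \<forall>f\<in>Hom C X Y. \<forall>g\<in>Hom C Y Z.
        Cmp C X Y Z g f \<in> Hom C X Z) \<and>
     (\<forall>X\<in>Obj C. \<forall>Y\<in>Obj C. \<forall>f\<in>Hom C X Y.
        Cmp C X X Y f (Idn C X) = f \<and> Cmp C X Y Y (Idn C Y) f = f) \<and>
     (\<forall>W\<in>Obj C. \<forall>X\<in>Obj C. \<forall>Y\<in>Obj C. \<forall>Z\<in>Obj C.
        \<forall>f\<in>Hom C W X. \<forall>g\<in>Hom C X Y. \<forall>h\<in>Hom C Y Z.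
          Cmp C W Y Z h (Cmp C W X Y g f) = Cmp C W X Z (Cmp C X Y Z h g) f)"

definition full_subcategory :: "('o, 'm) cat \<Rightarrow> ('o \<Rightarrow> bool) \<Rightarrow> ('o, 'm) cat" where
  "full_subcategory C P = C\<lparr>Obj := {X \<in> Obj C. P X}\<rparr>"

record ('o1, 'm1, 'o2, 'm2) ftor =
  FObj :: "'o1 \<Rightarrow> 'o2"
  FMor :: "'o1 \<Rightarrow> 'o1 \<Rightarrow> 'm1 \<Rightarrow> 'm2"

definition is_functor ::
  "('o1, 'm1) cat \<Rightarrow> ('o2, 'm2) cat \<Rightarrow> ('o1, 'm1, 'o2, 'm2) ftor \<Rightarrow> bool" where
  "is_functor C D F \<longleftrightarrow> category C \<and> category D \<and>
     (\<forall>X\<in>Obj C. FObj F X \<in> Obj D) \<and>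
     (\<forall>X\<in>Obj C. \<forall>Y\<in>Obj C. \<forall>f\<in>Hom C X Y. FMor F X Y f \<in> Hom D (FObj F X) (FObj F Y)) \<and>
     (\<forall>X\<in>Obj C. FMor F X X (Idn C X) = Idn D (FObj F X)) \<and>
     (\<forall>X\<in>Obj C. \<forall>Y\<in>Obj C. \<forall>Z\<in>Obj C. \<forall>f\<in>Hom C X Y. \<forall>g\<in>Hom C Y Z.
        FMor F X Z (Cmp C X Y Z g f) =
          Cmp D (FObj F X) (FObj F Y) (FObj F Z) (FMor F Y Z g) (FMor F X Y f))"

definition id_functor :: "('o, 'm, 'o, 'm) ftor" where
  "id_functor = \<lparr>FObj = (\<lambda>X. X), FMor = (\<lambda>X Y f. f)\<rparr>"

definition comp_functor ::
  "('o2, 'm2, 'o3, 'm3) ftor \<Rightarrow> ('o1, 'm1, 'o2, 'm2) ftor \<Rightarrow> ('o1, 'm1, 'o3, 'm3) ftor"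
  (infixl "\<circ>\<^sub>F" 55) where
  "G \<circ>\<^sub>F F =
     \<lparr>FObj = (\<lambda>X. FObj G (FObj F X)),
      FMor = (\<lambda>X Y f. FMor G (FObj F X) (FObj F Y) (FMor F X Y f))\<rparr>"

definition natural_transformation ::
  "('o1, 'm1) cat \<Rightarrow> ('o2, 'm2) cat \<Rightarrow> ('o1, 'm1, 'o2, 'm2) ftor \<Rightarrow>
   ('o1, 'm1, 'o2, 'm2) ftor \<Rightarrow> ('o1 \<Rightarrow> 'm2) \<Rightarrow> bool" where
  "natural_transformation C D F G \<eta> \<longleftrightarrow> is_functor C D F \<and> is_functor C D G \<and>
     (\<forall>X\<in>Obj C. \<eta> X \<in> Hom D (FObj F X) (FObj G X)) \<and>
     (\<forall>X\<in>Obj C. \<forall>Y\<in>Obj C. \<forall>f\<in>Hom C X Y.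
        Cmp D (FObj F X) (FObj F Y) (FObj G Y) (\<eta> Y) (FMor F X Y f) =
        Cmp D (FObj F X) (FObj G X) (FObj G Y) (FMor G X Y f) (\<eta> X))"

definition fully_faithful ::
  "('o1, 'm1) cat \<Rightarrow> ('o2, 'm2) cat \<Rightarrow> ('o1, 'm1, 'o2, 'm2) ftor \<Rightarrow> bool" where
  "fully_faithful C D F \<longleftrightarrow>
     (\<forall>X\<in>Obj C. \<forall>Y\<in>Obj C. bij_betw (FMor F X Y) (Hom C X Y) (Hom D (FObj F X) (FObj F Y)))"

text \<open>
  \<open>left_adjoint A B G F\<close>: the functor \<open>G : B \<rightarrow> A\<close> is left adjoint to \<open>F : A \<rightarrow> B\<close>, i.e. there
  are bijections \<open>\<Phi> : Hom\<^sub>A(G b, a) \<rightarrow> Hom\<^sub>B(b, F a)\<close>, natural in \<open>b\<close> and \<open>a\<close> jointly: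
  \<open>\<Phi> (h \<circ> f \<circ> G g) = F h \<circ> \<Phi> f \<circ> g\<close> for \<open>g : b' \<rightarrow> b\<close>, \<open>f : G b \<rightarrow> a\<close>, \<open>h : a \<rightarrow> a'\<close>.
\<close>

definition left_adjoint ::
  "('oa, 'ma) cat \<Rightarrow> ('ob, 'mb) cat \<Rightarrow> ('ob, 'mb, 'oa, 'ma) ftor \<Rightarrow>
   ('oa, 'ma, 'ob, 'mb) ftor \<Rightarrow> bool" where
  "left_adjoint A B G F \<longleftrightarrow> is_functor B A G \<and> is_functor A B F \<and>
     (\<exists>\<Phi>. (\<forall>b\<in>Obj B. \<forall>a\<in>Obj A.
             bij_betw (\<Phi> b a) (Hom A (FObj G b) a) (Hom B b (FObj F a))) \<and>
          (\<forall>b\<in>Obj B. \<forall>b'\<in>Obj B. \<forall>a\<in>Obj A. \<forall>a'\<in>Obj A.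
             \<forall>g\<in>Hom B b' b. \<forall>f\<in>Hom A (FObj G b) a. \<forall>h\<in>Hom A a a'.
               \<Phi> b' a' (Cmp A (FObj G b') a a' h
                          (Cmp A (FObj G b') (FObj G b) a f (FMor G b' b g))) =
               Cmp B b' (FObj F a) (FObj F a') (FMor F a a' h)
                 (Cmp B b' b (FObj F a) (\<Phi> b a f) g)))"

definition exhibits_reflective ::
  "('oa, 'ma) cat \<Rightarrow> ('ob, 'mb) cat \<Rightarrow> ('oa, 'ma, 'ob, 'mb) ftor \<Rightarrow>
   ('ob, 'mb, 'oa, 'ma) ftor \<Rightarrow> bool" where
  "exhibits_reflective A B F G \<longleftrightarrow>
     is_functor A B F \<and> fully_faithful A B F \<and> left_adjoint A B G F"


section \<open>Pre-e.pm.t. spaces and e.m.t. spaces\<close>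

text \<open>
  The underlying set of a space \<open>(X, \<tau>, d)\<close> is a subset of the type \<open>'u\<close>, which plays the role
  of the universe, and is recovered as \<open>topspace \<tau>\<close>. The distance is a function on the whole
  type; it is normalised to \<open>undefined\<close> outside \<open>X \<times> X\<close>, so that equality of records is equality
  of triples.
\<close>

record 'u space =
  Top :: "'u topology"
  Dst :: "'u \<Rightarrow> 'u \<Rightarrow> ennreal"

abbreviation pts :: "'u space \<Rightarrow> 'u set" where
  "pts S \<equiv> topspace (Top S)"

definition extended_pseudodistance :: "'u set \<Rightarrow> ('u \<Rightarrow> 'u \<Rightarrow> ennreal) \<Rightarrow> bool" where
  "extended_pseudodistance X d \<longleftrightarrow>
     (\<forall>x\<in>X. d x x = 0) \<and>
     (\<forall>x\<in>X. \<forall>y\<in>X. d x y = d y x) \<and>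
     (\<forall>x\<in>X. \<forall>y\<in>X. \<forall>z\<in>X. d x z \<le> d x y + d y z)"

definition extended_distance :: "'u set \<Rightarrow> ('u \<Rightarrow> 'u \<Rightarrow> ennreal) \<Rightarrow> bool" where
  "extended_distance X d \<longleftrightarrow>
     extended_pseudodistance X d \<and> (\<forall>x\<in>X. \<forall>y\<in>X. d x y = 0 \<longrightarrow> x = y)"

definition pre_epmt_space :: "'u space \<Rightarrow> bool" where
  "pre_epmt_space S \<longleftrightarrow> extended_pseudodistance (pts S) (Dst S) \<and>
     (\<forall>x y. \<not> (x \<in> pts S \<and> y \<in> pts S) \<longrightarrow> Dst S x y = undefined)"

text \<open>Functions in \<open>LIP_b1 \<tau> d\<close> are unconstrained outside \<open>topspace \<tau>\<close>.\<close>

definition LIP_b1 :: "'u topology \<Rightarrow> ('u \<Rightarrow> 'u \<Rightarrow> ennreal) \<Rightarrow> ('u \<Rightarrow> real) set" where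
  "LIP_b1 \<tau> d = {f. bounded (f ` topspace \<tau>) \<and> continuous_map \<tau> euclideanreal f \<and>
     (\<forall>x\<in>topspace \<tau>. \<forall>y\<in>topspace \<tau>. ennreal \<bar>f x - f y\<bar> \<le> d x y)}"

definition LIP_sup :: "'u topology \<Rightarrow> ('u \<Rightarrow> 'u \<Rightarrow> ennreal) \<Rightarrow> 'u \<Rightarrow> 'u \<Rightarrow> ennreal" where
  "LIP_sup \<tau> d x y = (SUP f\<in>LIP_b1 \<tau> d. ennreal \<bar>f x - f y\<bar>)"

definition initial_topology :: "'u set \<Rightarrow> ('u \<Rightarrow> real) set \<Rightarrow> 'u topology" where
  "initial_topology X F =
     topology_generated_by (insert X {{x \<in> X. f x \<in> U} | f U. f \<in> F \<and> open U})"

definition emt_space :: "'u space \<Rightarrow> bool" where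
  "emt_space S \<longleftrightarrow> pre_epmt_space S \<and>
     extended_distance (pts S) (Dst S) \<and>
     Top S = initial_topology (pts S) (LIP_b1 (Top S) (Dst S)) \<and>
     (\<forall>x\<in>pts S. \<forall>y\<in>pts S. Dst S x y = LIP_sup (Top S) (Dst S) x y)"

text \<open>Maps between sets are represented by their extensional functions, as in \<open>\<rightarrow>\<^sub>E\<close>.\<close>

definition cont_short :: "'u space \<Rightarrow> 'u space \<Rightarrow> ('u \<Rightarrow> 'u) set" where
  "cont_short S T = {\<phi> \<in> pts S \<rightarrow>\<^sub>E pts T. continuous_map (Top S) (Top T) \<phi> \<and>
     (\<forall>x\<in>pts S. \<forall>y\<in>pts S. Dst T (\<phi> x) (\<phi> y) \<le> Dst S x y)}"

definition PreExtPsiMetTop :: "('u space, 'u \<Rightarrow> 'u) cat" where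
  "PreExtPsiMetTop =
     \<lparr>Obj = {S. pre_epmt_space S},
      Hom = cont_short,
      Idn = (\<lambda>S. \<lambda>x\<in>pts S. x),
      Cmp = (\<lambda>S T R \<psi> \<phi>. compose (pts S) \<psi> \<phi>)\<rparr>"

definition ExtMetTop :: "('u space, 'u \<Rightarrow> 'u) cat" where
  "ExtMetTop = full_subcategory PreExtPsiMetTop emt_space"

definition incl :: "('u space, 'u \<Rightarrow> 'u, 'u space, 'u \<Rightarrow> 'u) ftor" where
  "incl = \<lparr>FObj = (\<lambda>S. S), FMor = (\<lambda>S T \<phi>. \<phi>)\<rparr>"


section \<open>The e.m.t.-fication\<close>

text \<open>
  The quotient of a set \<open>X \<subseteq> 'u\<close> is a set of subsets of \<open>'u\<close>, and no type contains its own
  power set. For the quotient to be again a space in the universe \<open>'u\<close>, its points have to be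
  named by elements of \<open>'u\<close>. A \<open>class_coding\<close> is an arbitrary assignment of such names; all
  that is required is that it gives different names to the different classes of any partition.
  By \<open>class_coding_ex\<close> every type has one.
\<close>

definition class_coding :: "('u set \<Rightarrow> 'u) \<Rightarrow> bool" where
  "class_coding \<kappa> \<longleftrightarrow>
     (\<forall>A B. A \<noteq> {} \<and> B \<noteq> {} \<and> A \<inter> B = {} \<longrightarrow> \<kappa> A \<noteq> \<kappa> B)"

lemma class_coding_ex: "\<exists>\<kappa> :: 'u set \<Rightarrow> 'u. class_coding \<kappa>"
proof -
  have "class_coding (\<lambda>A :: 'u set. SOME x. x \<in> A)"
    unfolding class_coding_def by (metis disjoint_iff some_in_eq)
  then show ?thesis by blast
qed

definition quotient_topology :: "'u topology \<Rightarrow> ('u \<Rightarrow> 'v) \<Rightarrow> 'v topology" where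
  "quotient_topology \<tau> p =
     topology (\<lambda>U. U \<subseteq> p ` topspace \<tau> \<and> openin \<tau> {x \<in> topspace \<tau>. p x \<in> U})"

lemma openin_quotient_topology:
  "openin (quotient_topology \<tau> p) U \<longleftrightarrow>
     U \<subseteq> p ` topspace \<tau> \<and> openin \<tau> {x \<in> topspace \<tau>. p x \<in> U}"
proof -
  have "istopology (\<lambda>U. U \<subseteq> p ` topspace \<tau> \<and> openin \<tau> {x \<in> topspace \<tau>. p x \<in> U})"
    unfolding istopology_def
  proof (intro conjI allI impI)
    fix S T
    assume S: "S \<subseteq> p ` topspace \<tau> \<and> openin \<tau> {x \<in> topspace \<tau>. p x \<in> S}"
      and T: "T \<subseteq> p ` topspace \<tau> \<and> openin \<tau> {x \<in> topspace \<tau>. p x \<in> T}"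
    then show "S \<inter> T \<subseteq> p ` topspace \<tau>" by blast
    have "{x \<in> topspace \<tau>. p x \<in> S \<inter> T} =
        {x \<in> topspace \<tau>. p x \<in> S} \<inter> {x \<in> topspace \<tau>. p x \<in> T}" by blast
    then show "openin \<tau> {x \<in> topspace \<tau>. p x \<in> S \<inter> T}" using S T by auto
  next
    fix K
    assume K: "\<forall>S\<in>K. S \<subseteq> p ` topspace \<tau> \<and> openin \<tau> {x \<in> topspace \<tau>. p x \<in> S}"
    then show "\<Union>K \<subseteq> p ` topspace \<tau>" by blast
    have "{x \<in> topspace \<tau>. p x \<in> \<Union>K} = (\<Union>S\<in>K. {x \<in> topspace \<tau>. p x \<in> S})" by blast
    then show "openin \<tau> {x \<in> topspace \<tau>. p x \<in> \<Union>K}" using K by auto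
  qed
  then show ?thesis unfolding quotient_topology_def by simp
qed

lemma quotient_map_quotient_topology: "quotient_map \<tau> (quotient_topology \<tau> p) p"
proof -
  have "{x \<in> topspace \<tau>. p x \<in> p ` topspace \<tau>} = topspace \<tau>" by blast
  then have "topspace (quotient_topology \<tau> p) = p ` topspace \<tau>"
    using openin_quotient_topology[of \<tau> p]
    by (metis openin_subset openin_topspace subset_antisym subset_refl)
  then show ?thesis
    by (auto simp: quotient_map_def openin_quotient_topology)
qed

definition emt_rel :: "'u space \<Rightarrow> 'u rel" where
  "emt_rel S =
     {(x, y). x \<in> pts S \<and> y \<in> pts S \<and> LIP_sup (Top S) (Dst S) x y = 0}"

definition emt_proj :: "('u set \<Rightarrow> 'u) \<Rightarrow> 'u space \<Rightarrow> 'u \<Rightarrow> 'u" where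
  "emt_proj \<kappa> S = (\<lambda>x\<in>pts S. \<kappa> (emt_rel S `` {x}))"

definition emt_pts :: "('u set \<Rightarrow> 'u) \<Rightarrow> 'u space \<Rightarrow> 'u set" where
  "emt_pts \<kappa> S = \<kappa> ` (pts S // emt_rel S)"

definition emt_dist :: "('u set \<Rightarrow> 'u) \<Rightarrow> 'u space \<Rightarrow> 'u \<Rightarrow> 'u \<Rightarrow> ennreal" where
  "emt_dist \<kappa> S a b =
     (if a \<in> emt_pts \<kappa> S \<and> b \<in> emt_pts \<kappa> S
      then THE r. \<exists>x\<in>pts S. \<exists>y\<in>pts S.
             emt_proj \<kappa> S x = a \<and> emt_proj \<kappa> S y = b \<and> r = LIP_sup (Top S) (Dst S) x y
      else undefined)"

definition emt_obj :: "('u set \<Rightarrow> 'u) \<Rightarrow> 'u space \<Rightarrow> 'u space" where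
  "emt_obj \<kappa> S =
     \<lparr>Top = initial_topology (emt_pts \<kappa> S)
              (LIP_b1 (quotient_topology (Top S) (emt_proj \<kappa> S)) (emt_dist \<kappa> S)),
      Dst = emt_dist \<kappa> S\<rparr>"

definition emt_mor ::
  "('u set \<Rightarrow> 'u) \<Rightarrow> 'u space \<Rightarrow> 'u space \<Rightarrow> ('u \<Rightarrow> 'u) \<Rightarrow> 'u \<Rightarrow> 'u" where
  "emt_mor \<kappa> S T \<phi> =
     (THE \<psi>. \<psi> \<in> cont_short (emt_obj \<kappa> S) (emt_obj \<kappa> T) \<and>
        compose (pts S) \<psi> (emt_proj \<kappa> S) = compose (pts S) (emt_proj \<kappa> T) \<phi>)"

definition emt ::
  "('u set \<Rightarrow> 'u) \<Rightarrow> ('u space, 'u \<Rightarrow> 'u, 'u space, 'u \<Rightarrow> 'u) ftor" where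
  "emt \<kappa> = \<lparr>FObj = emt_obj \<kappa>, FMor = emt_mor \<kappa>\<rparr>"

end

theory Submission
  imports Defs
begin

text \<open>
  Every \<open>f \<in> LIP_b1 \<tau> d\<close> is constant on the classes of \<open>emt_rel\<close>, so composition with the
  projection identifies \<open>LIP_b1 \<tau> d\<close> with the corresponding set for the quotient topology and the
  quotient distance. The latter set does not change when the quotient topology is replaced by the
  initial topology it induces, and hence the quotient is an e.m.t. space. A continuous-short map
  into an e.m.t. space pulls the test functions of the target back to test functions of the source,
  which determine topology and distance of both the quotient and the target; hence it
  factors uniquely through the projection. This universal property gives the adjunction.
\<close>

section \<open>Test functions and initial topologies\<close>

lemma LIP_sup_upper: "f \<in> LIP_b1 \<tau> d \<Longrightarrow> ennreal \<bar>f x - f y\<bar> \<le> LIP_sup \<tau> d x y"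
  unfolding LIP_sup_def by (rule SUP_upper)

lemma LIP_sup_refl: "LIP_sup \<tau> d x x = 0"
  \<comment> \<open>The supremum is of the constant 0; \<open>bot_ennreal\<close> settles the empty
    index set that \<open>SUP_constant\<close> splits off.\<close>
  unfolding LIP_sup_def by (simp add: SUP_constant bot_ennreal)

lemma LIP_sup_commute: "LIP_sup \<tau> d x y = LIP_sup \<tau> d y x"
  unfolding LIP_sup_def by (simp add: abs_minus_commute)

lemma LIP_sup_triangle: "LIP_sup \<tau> d x z \<le> LIP_sup \<tau> d x y + LIP_sup \<tau> d y z"
proof -
  have "ennreal \<bar>f x - f z\<bar> \<le> LIP_sup \<tau> d x y + LIP_sup \<tau> d y z" if "f \<in> LIP_b1 \<tau> d" for f
  proof -
    have "ennreal \<bar>f x - f z\<bar> \<le> ennreal (\<bar>f x - f y\<bar> + \<bar>f y - f z\<bar>)"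
      by (rule ennreal_leI) linarith
    also have "\<dots> = ennreal \<bar>f x - f y\<bar> + ennreal \<bar>f y - f z\<bar>"
      by simp
    also have "\<dots> \<le> LIP_sup \<tau> d x y + LIP_sup \<tau> d y z"
      using that by (intro add_mono LIP_sup_upper)
    finally show ?thesis .
  qed
  then show ?thesis
    unfolding LIP_sup_def[of \<tau> d x z] by (rule SUP_least)
qed

lemma LIP_sup_le:
  assumes "x \<in> topspace \<tau>" "y \<in> topspace \<tau>"
  shows "LIP_sup \<tau> d x y \<le> d x y"
  unfolding LIP_sup_def using assms by (intro SUP_least) (auto simp: LIP_b1_def)

text \<open>This is what lets test functions descend to the quotient: the distance being a supremum
  over test functions, it vanishes only if each of them fails to separate the two points.\<close>

lemma LIP_sup_eq_0_D:
  assumes "LIP_sup \<tau> d x y = 0" "f \<in> LIP_b1 \<tau> d"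
  shows "f x = f y"
  using LIP_sup_upper[OF assms(2), of x y] assms(1) by (simp add: ennreal_eq_0_iff)

lemma LIP_b1_compose:
  assumes f: "f \<in> LIP_b1 \<sigma> e" and \<phi>: "continuous_map \<tau> \<sigma> \<phi>"
    and short: "\<And>x y. x \<in> topspace \<tau> \<Longrightarrow> y \<in> topspace \<tau> \<Longrightarrow> e (\<phi> x) (\<phi> y) \<le> d x y"
  shows "f \<circ> \<phi> \<in> LIP_b1 \<tau> d"
proof -
  have sub: "\<phi> ` topspace \<tau> \<subseteq> topspace \<sigma>"
    using \<phi> by (rule continuous_map_image_subset_topspace)
  have "bounded ((f \<circ> \<phi>) ` topspace \<tau>)"
    using f sub unfolding LIP_b1_def image_comp[symmetric] by (blast intro: bounded_subset)
  moreover have "ennreal \<bar>f (\<phi> x) - f (\<phi> y)\<bar> \<le> d x y"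
    if "x \<in> topspace \<tau>" "y \<in> topspace \<tau>" for x y
    using f sub that short[OF that] unfolding LIP_b1_def by (blast intro: order_trans)
  ultimately show ?thesis
    using f \<phi> by (auto simp: LIP_b1_def intro: continuous_map_compose)
qed

text \<open>Pulling back along \<open>\<phi>\<close> turns each test function of the target into one
  of the source, so the supremum on the left runs over differences that already occur on the
  right.\<close>

lemma LIP_sup_contract:
  assumes \<phi>: "continuous_map \<tau> \<sigma> \<phi>"
    and short: "\<And>x y. x \<in> topspace \<tau> \<Longrightarrow> y \<in> topspace \<tau> \<Longrightarrow> e (\<phi> x) (\<phi> y) \<le> d x y"
  shows "LIP_sup \<sigma> e (\<phi> x) (\<phi> y) \<le> LIP_sup \<tau> d x y"
  unfolding LIP_sup_def[of \<sigma>]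
proof (rule SUP_least)
  fix f assume "f \<in> LIP_b1 \<sigma> e"
  then have "f \<circ> \<phi> \<in> LIP_b1 \<tau> d"
    using \<phi> short by (rule LIP_b1_compose)
  from LIP_sup_upper[OF this, of x y] show "ennreal \<bar>f (\<phi> x) - f (\<phi> y)\<bar> \<le> LIP_sup \<tau> d x y"
    by simp
qed

section \<open>Universal property of initial topologies\<close>

lemma topspace_initial_topology [simp]: "topspace (initial_topology X F) = X"
  unfolding initial_topology_def topology_generated_by_topspace by auto

text \<open>Preimages of generators decide continuity into a generated topology. Conversely, each
  \<open>f\<close> in \<open>F\<close> is continuous on the initial topology because its preimages
  of open sets are generators.\<close>

lemma continuous_map_into_initial_topology:
  "continuous_map \<sigma> (initial_topology X F) \<phi> \<longleftrightarrow>
     \<phi> \<in> topspace \<sigma> \<rightarrow> X \<and> (\<forall>f\<in>F. continuous_map \<sigma> euclideanreal (f \<circ> \<phi>))"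
  (is "?lhs \<longleftrightarrow> ?rhs")
proof
  assume L: ?lhs
  then have X: "\<phi> \<in> topspace \<sigma> \<rightarrow> X"
    using continuous_map_funspace[OF L] by simp
  have "continuous_map (initial_topology X F) euclideanreal f" if "f \<in> F" for f
    unfolding continuous_map
  proof (intro conjI allI impI)
    fix U :: "real set" assume "openin euclideanreal U"
    then have "{x \<in> X. f x \<in> U} \<in> insert X {{x \<in> X. f x \<in> U} | f U. f \<in> F \<and> open U}"
      using that by auto
    then show "openin (initial_topology X F) {x \<in> topspace (initial_topology X F). f x \<in> U}"
      unfolding topspace_initial_topology unfolding initial_topology_def
      by (rule topology_generated_by_Basis)
  qed auto
  with L X show ?rhs
    by (blast intro: continuous_map_compose)
next
  assume R: ?rhs
  show ?lhs
    unfolding initial_topology_def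
  proof (rule continuous_on_generated_topo)
    fix V assume "V \<in> insert X {{x \<in> X. f x \<in> U} | f U. f \<in> F \<and> open U}"
    then consider "V = X" | f U where "V = {x \<in> X. f x \<in> U}" "f \<in> F" "open U"
      by auto
    then show "openin \<sigma> (\<phi> -` V \<inter> topspace \<sigma>)"
    proof cases
      case 1
      with R have "\<phi> -` V \<inter> topspace \<sigma> = topspace \<sigma>" by auto
      then show ?thesis by simp
    next
      case (2 f U)
      with R have "\<phi> -` V \<inter> topspace \<sigma> = {x \<in> topspace \<sigma>. (f \<circ> \<phi>) x \<in> U}" by auto
      moreover have "openin \<sigma> {x \<in> topspace \<sigma>. (f \<circ> \<phi>) x \<in> U}"
        using R 2 openin_continuous_map_preimage[of \<sigma> euclideanreal "f \<circ> \<phi>" U]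
        by auto
      ultimately show ?thesis by simp
    qed
  qed (use R in auto)
qed

lemma LIP_b1_topology_cong:
  assumes "topspace \<sigma> = topspace \<tau>"
    and "\<And>f. f \<in> LIP_b1 \<tau> d \<Longrightarrow> continuous_map \<sigma> euclideanreal f"
    and "\<And>f. continuous_map \<sigma> euclideanreal f \<Longrightarrow> continuous_map \<tau> euclideanreal f"
  shows "LIP_b1 \<sigma> d = LIP_b1 \<tau> d"
  using assms unfolding LIP_b1_def by auto

text \<open>The initial topology is coarser than \<open>\<tau>\<close>, so no new continuous
  functions appear; the old test functions stay continuous by construction. Boundedness and the
  Lipschitz bound do not see the topology beyond its carrier.\<close>

lemma LIP_b1_initial_topology:
  "LIP_b1 (initial_topology (topspace \<tau>) (LIP_b1 \<tau> d)) d = LIP_b1 \<tau> d"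
proof -
  let ?I = "initial_topology (topspace \<tau>) (LIP_b1 \<tau> d)"
  have finer: "continuous_map \<tau> ?I (\<lambda>x. x)"
    by (auto simp: continuous_map_into_initial_topology LIP_b1_def comp_def)
  \<comment> \<open>Reading the universal property for the identity of \<open>?I\<close> extracts
    the continuity of each generating function.\<close>
  have "continuous_map ?I ?I id"
    by simp
  then have "continuous_map ?I euclideanreal (f \<circ> id)" if "f \<in> LIP_b1 \<tau> d" for f
    using that unfolding continuous_map_into_initial_topology by blast
  then have "continuous_map ?I euclideanreal f" if "f \<in> LIP_b1 \<tau> d" for f
    using that by simp
  moreover have "continuous_map \<tau> euclideanreal f" if "continuous_map ?I euclideanreal f" for f
    using continuous_map_compose[OF finer that] by (simp add: comp_def)
  ultimately show ?thesis
    by (intro LIP_b1_topology_cong) simp_all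
qed

section \<open>The quotient\<close>

lemma equiv_emt_rel: "equiv (pts S) (emt_rel S)"
proof (rule equivI)
  show "refl_on (pts S) (emt_rel S)"
    by (auto simp: refl_on_def emt_rel_def LIP_sup_refl)
  show "sym (emt_rel S)"
    by (auto simp: sym_def emt_rel_def LIP_sup_commute)
  show "trans (emt_rel S)"
  proof (rule transI)
    fix x y z assume "(x, y) \<in> emt_rel S" "(y, z) \<in> emt_rel S"
    then show "(x, z) \<in> emt_rel S"
      using LIP_sup_triangle[of "Top S" "Dst S" x z y] by (auto simp: emt_rel_def)
  qed
qed (auto simp: emt_rel_def)

lemma emt_proj_image: "emt_proj \<kappa> S ` pts S = emt_pts \<kappa> S"
  by (auto simp: emt_proj_def emt_pts_def quotient_def)

text \<open>A coding is only known to separate disjoint nonempty sets. This suffices because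
  equivalence classes are nonempty and are either equal or disjoint.\<close>

lemma emt_proj_eq_iff:
  assumes "class_coding \<kappa>" and x: "x \<in> pts S" and y: "y \<in> pts S"
  shows "emt_proj \<kappa> S x = emt_proj \<kappa> S y \<longleftrightarrow> LIP_sup (Top S) (Dst S) x y = 0"
proof -
  let ?A = "emt_rel S `` {x}" and ?B = "emt_rel S `` {y}"
  have ne: "x \<in> ?A" "y \<in> ?B"
    using x y by (auto simp: emt_rel_def LIP_sup_refl)
  have quot: "?A \<in> pts S // emt_rel S" "?B \<in> pts S // emt_rel S"
    using x y by (auto intro: quotientI)
  have "\<kappa> ?A = \<kappa> ?B \<longleftrightarrow> ?A = ?B"
  proof
    assume "\<kappa> ?A = \<kappa> ?B"
    then have "?A \<inter> ?B \<noteq> {}"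
      using ne \<open>class_coding \<kappa>\<close> unfolding class_coding_def by (metis empty_iff)
    then show "?A = ?B"
      using quotient_disj[OF equiv_emt_rel quot] by simp
  qed simp
  also have "\<dots> \<longleftrightarrow> (x, y) \<in> emt_rel S"
    using equiv_emt_rel x y by (rule eq_equiv_class_iff)
  finally show ?thesis
    using x y by (simp add: emt_proj_def emt_rel_def)
qed

lemma emt_proj_mem: "x \<in> pts S \<Longrightarrow> emt_proj \<kappa> S x \<in> emt_pts \<kappa> S"
  using emt_proj_image by fast

text \<open>The definite description in \<open>emt_dist\<close> is meaningful because
  \<open>LIP_sup\<close> does not depend on the representatives; all later work with the quotient
  distance goes through this equation.\<close>

lemma emt_dist_proj:
  assumes \<kappa>: "class_coding \<kappa>" and x: "x \<in> pts S" and y: "y \<in> pts S"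
  shows "emt_dist \<kappa> S (emt_proj \<kappa> S x) (emt_proj \<kappa> S y) = LIP_sup (Top S) (Dst S) x y"
proof -
  let ?L = "LIP_sup (Top S) (Dst S)"
  have uniq: "?L x' y' = ?L x y"
    if "x' \<in> pts S" "y' \<in> pts S" "emt_proj \<kappa> S x' = emt_proj \<kappa> S x"
      "emt_proj \<kappa> S y' = emt_proj \<kappa> S y" for x' y'
  proof -
    have 0: "?L x' x = 0" "?L y' y = 0" "?L x x' = 0" "?L y y' = 0"
      using that x y emt_proj_eq_iff[OF \<kappa>] by metis+
    \<comment> \<open>The detour from \<open>x'\<close> to \<open>y'\<close> via \<open>x\<close>
      and \<open>y\<close> costs nothing extra, as its two outer legs have length 0.\<close>
    have "?L x' y' \<le> ?L x y"
      using LIP_sup_triangle[of "Top S" "Dst S" x' y' x] LIP_sup_triangle[of "Top S" "Dst S" x y' y] 0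
      by (auto intro: order_trans)
    moreover have "?L x y \<le> ?L x' y'"
      using LIP_sup_triangle[of "Top S" "Dst S" x y x'] LIP_sup_triangle[of "Top S" "Dst S" x' y y'] 0
      by (auto intro: order_trans)
    ultimately show ?thesis by (rule antisym)
  qed
  have "(THE r. \<exists>x'\<in>pts S. \<exists>y'\<in>pts S. emt_proj \<kappa> S x' = emt_proj \<kappa> S x \<and>
           emt_proj \<kappa> S y' = emt_proj \<kappa> S y \<and> r = ?L x' y') = ?L x y"
    using x y uniq by (intro the_equality) blast+
  then show ?thesis
    using x y by (simp add: emt_dist_def emt_proj_mem)
qed

section \<open>Test functions on the quotient\<close>

abbreviation emt_qtop :: "('u set \<Rightarrow> 'u) \<Rightarrow> 'u space \<Rightarrow> 'u topology" where
  "emt_qtop \<kappa> S \<equiv> quotient_topology (Top S) (emt_proj \<kappa> S)"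

lemma topspace_emt_qtop: "topspace (emt_qtop \<kappa> S) = emt_pts \<kappa> S"
  using quotient_imp_surjective_map[OF quotient_map_quotient_topology] emt_proj_image by metis

lemma LIP_b1_emt_qtop_compose:
  assumes \<kappa>: "class_coding \<kappa>" and g: "g \<in> LIP_b1 (emt_qtop \<kappa> S) (emt_dist \<kappa> S)"
  shows "g \<circ> emt_proj \<kappa> S \<in> LIP_b1 (Top S) (Dst S)"
  using g quotient_imp_continuous_map[OF quotient_map_quotient_topology]
  by (rule LIP_b1_compose) (simp add: emt_dist_proj[OF \<kappa>] LIP_sup_le)

text \<open>For the converse, boundedness descends because the projection is onto, continuity
  because it is a quotient map, and the Lipschitz bound because the quotient distance is the
  supremum over all test functions upstairs, among them
  \<open>g \<circ> emt_proj \<kappa> S\<close>.\<close>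

lemma LIP_b1_emt_qtop_iff:
  assumes \<kappa>: "class_coding \<kappa>"
  shows "g \<in> LIP_b1 (emt_qtop \<kappa> S) (emt_dist \<kappa> S) \<longleftrightarrow>
    g \<circ> emt_proj \<kappa> S \<in> LIP_b1 (Top S) (Dst S)"
proof
  assume f: "g \<circ> emt_proj \<kappa> S \<in> LIP_b1 (Top S) (Dst S)"
  have "bounded (g ` emt_pts \<kappa> S)"
    using f unfolding LIP_b1_def emt_proj_image[symmetric] image_comp by blast
  moreover have "continuous_map (emt_qtop \<kappa> S) euclideanreal g"
    using f continuous_compose_quotient_map[OF quotient_map_quotient_topology]
    by (auto simp: LIP_b1_def)
  moreover have "ennreal \<bar>g a - g b\<bar> \<le> emt_dist \<kappa> S a b"
    if "a \<in> emt_pts \<kappa> S" "b \<in> emt_pts \<kappa> S" for a b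
  proof -
    from that obtain x y where xy: "x \<in> pts S" "y \<in> pts S"
      "a = emt_proj \<kappa> S x" "b = emt_proj \<kappa> S y"
      unfolding emt_proj_image[symmetric] by blast
    then show ?thesis
      using LIP_sup_upper[OF f, of x y] by (simp add: emt_dist_proj[OF \<kappa>])
  qed
  ultimately show "g \<in> LIP_b1 (emt_qtop \<kappa> S) (emt_dist \<kappa> S)"
    by (simp add: LIP_b1_def topspace_emt_qtop)
qed (rule LIP_b1_emt_qtop_compose[OF \<kappa>])

lemma LIP_b1_factor:
  assumes \<kappa>: "class_coding \<kappa>" and f: "f \<in> LIP_b1 (Top S) (Dst S)"
  obtains g where "g \<in> LIP_b1 (emt_qtop \<kappa> S) (emt_dist \<kappa> S)"
    "\<And>x. x \<in> pts S \<Longrightarrow> g (emt_proj \<kappa> S x) = f x"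
proof
  \<comment> \<open>Any representative serves, since \<open>f\<close> is constant on
    classes.\<close>
  define g where "g a = f (SOME x. x \<in> pts S \<and> emt_proj \<kappa> S x = a)" for a
  show eq: "g (emt_proj \<kappa> S x) = f x" if x: "x \<in> pts S" for x
  proof -
    let ?y = "SOME y. y \<in> pts S \<and> emt_proj \<kappa> S y = emt_proj \<kappa> S x"
    have "?y \<in> pts S \<and> emt_proj \<kappa> S ?y = emt_proj \<kappa> S x"
      by (rule someI[of _ x]) (simp add: x)
    then have "f ?y = f x"
      using x emt_proj_eq_iff[OF \<kappa>] LIP_sup_eq_0_D[OF _ f] by blast
    then show ?thesis by (simp add: g_def)
  qed
  \<comment> \<open>The composite agrees with \<open>f\<close> on \<open>pts S\<close> only, which
    is all that membership in \<open>LIP_b1\<close> constrains.\<close>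
  have "continuous_map (Top S) euclideanreal (g \<circ> emt_proj \<kappa> S)"
    using f by (auto simp: LIP_b1_def eq intro: continuous_map_eq[of _ _ f])
  then have "g \<circ> emt_proj \<kappa> S \<in> LIP_b1 (Top S) (Dst S)"
    using f by (auto simp: LIP_b1_def eq cong: image_cong)
  then show "g \<in> LIP_b1 (emt_qtop \<kappa> S) (emt_dist \<kappa> S)"
    by (simp add: LIP_b1_emt_qtop_iff[OF \<kappa>])
qed

section \<open>The quotient as an e.m.t. space\<close>

lemma pts_emt_obj [simp]: "pts (emt_obj \<kappa> S) = emt_pts \<kappa> S"
  by (simp add: emt_obj_def)

lemma Dst_emt_obj [simp]: "Dst (emt_obj \<kappa> S) = emt_dist \<kappa> S"
  by (simp add: emt_obj_def)

text \<open>The topology of \<open>emt_obj\<close> is built from the test functions of the quotient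
  topology. That it has the same ones itself makes the e.m.t. conditions, which refer to its own
  topology, accessible.\<close>

lemma LIP_b1_emt_obj:
  "LIP_b1 (Top (emt_obj \<kappa> S)) (emt_dist \<kappa> S) = LIP_b1 (emt_qtop \<kappa> S) (emt_dist \<kappa> S)"
  using LIP_b1_initial_topology[of "emt_qtop \<kappa> S" "emt_dist \<kappa> S"]
  by (simp add: emt_obj_def topspace_emt_qtop)

text \<open>The metric axioms come from those of \<open>LIP_sup\<close> on representatives. The
  topology is initial for its own test functions by \<open>LIP_b1_emt_obj\<close>, and the distance
  is recovered as a supremum because every test function of \<open>S\<close> factors through the
  projection.\<close>

lemma emt_space_emt_obj:
  assumes \<kappa>: "class_coding \<kappa>"
  shows "emt_space (emt_obj \<kappa> S)"
proof -
  let ?p = "emt_proj \<kappa> S" and ?d = "emt_dist \<kappa> S" and ?L = "LIP_sup (Top S) (Dst S)"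
  \<comment> \<open>Quantifiers over points of the quotient become quantifiers over representatives,
    where \<open>emt_dist_proj\<close> applies; nested quantifiers are handled by repeated
    rewriting.\<close>
  have ball: "(\<forall>a\<in>emt_pts \<kappa> S. P a) \<longleftrightarrow> (\<forall>x\<in>pts S. P (?p x))" for P
    unfolding emt_proj_image[symmetric] by blast
  have dist: "extended_distance (emt_pts \<kappa> S) ?d"
    unfolding extended_distance_def extended_pseudodistance_def ball
    by (simp add: emt_dist_proj[OF \<kappa>] emt_proj_eq_iff[OF \<kappa>]
        LIP_sup_refl LIP_sup_commute LIP_sup_triangle)
  have outside: "?d x y = undefined" if "\<not> (x \<in> emt_pts \<kappa> S \<and> y \<in> emt_pts \<kappa> S)" for x y
    using that by (auto simp: emt_dist_def)
  have "?L x y = LIP_sup (Top (emt_obj \<kappa> S)) ?d (?p x) (?p y)"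
    if x: "x \<in> pts S" and y: "y \<in> pts S" for x y
  proof (rule antisym)
    show "?L x y \<le> LIP_sup (Top (emt_obj \<kappa> S)) ?d (?p x) (?p y)"
      unfolding LIP_sup_def[of "Top S"]
    proof (rule SUP_least)
      fix f assume "f \<in> LIP_b1 (Top S) (Dst S)"
      then obtain g where g: "g \<in> LIP_b1 (emt_qtop \<kappa> S) ?d"
        "\<And>x. x \<in> pts S \<Longrightarrow> g (?p x) = f x"
        using LIP_b1_factor[OF \<kappa>] by blast
      then show "ennreal \<bar>f x - f y\<bar> \<le> LIP_sup (Top (emt_obj \<kappa> S)) ?d (?p x) (?p y)"
        using LIP_sup_upper[of g _ ?d "?p x" "?p y"] x y by (simp add: LIP_b1_emt_obj)
    qed
    show "LIP_sup (Top (emt_obj \<kappa> S)) ?d (?p x) (?p y) \<le> ?L x y"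
      using LIP_sup_le[of "?p x" "Top (emt_obj \<kappa> S)" "?p y" ?d] x y
      by (simp add: emt_proj_mem emt_dist_proj[OF \<kappa>])
  qed
  then have sup: "\<forall>a\<in>emt_pts \<kappa> S. \<forall>b\<in>emt_pts \<kappa> S. ?d a b = LIP_sup (Top (emt_obj \<kappa> S)) ?d a b"
    unfolding ball by (simp add: emt_dist_proj[OF \<kappa>])
  have top: "Top (emt_obj \<kappa> S) =
      initial_topology (emt_pts \<kappa> S) (LIP_b1 (Top (emt_obj \<kappa> S)) ?d)"
    unfolding LIP_b1_emt_obj by (simp add: emt_obj_def)
  show ?thesis
    unfolding emt_space_def pre_epmt_space_def pts_emt_obj Dst_emt_obj
    using dist outside sup top unfolding extended_distance_def by blast
qed

text \<open>Continuity into the initial topology is tested on its generating functions, whose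
  pullbacks are test functions of \<open>S\<close>. Shortness is the bound of \<open>LIP_sup\<close>
  by the given distance.\<close>

lemma emt_proj_cont_short:
  assumes \<kappa>: "class_coding \<kappa>"
  shows "emt_proj \<kappa> S \<in> cont_short S (emt_obj \<kappa> S)"
proof -
  have "continuous_map (Top S) (Top (emt_obj \<kappa> S)) (emt_proj \<kappa> S)"
    unfolding emt_obj_def space.simps continuous_map_into_initial_topology
  proof (intro conjI ballI)
    fix g assume "g \<in> LIP_b1 (emt_qtop \<kappa> S) (emt_dist \<kappa> S)"
    then have "g \<circ> emt_proj \<kappa> S \<in> LIP_b1 (Top S) (Dst S)"
      by (rule LIP_b1_emt_qtop_compose[OF \<kappa>])
    then show "continuous_map (Top S) euclideanreal (g \<circ> emt_proj \<kappa> S)"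
      by (simp add: LIP_b1_def)
  qed (simp add: emt_proj_mem)
  moreover have "emt_proj \<kappa> S \<in> pts S \<rightarrow>\<^sub>E emt_pts \<kappa> S"
    by (auto simp: emt_proj_mem) (simp add: emt_proj_def)
  ultimately show ?thesis
    by (simp add: cont_short_def emt_dist_proj[OF \<kappa>] LIP_sup_le)
qed

section \<open>The universal property\<close>

lemma cont_short_extensional: "\<phi> \<in> cont_short S T \<Longrightarrow> \<phi> \<in> extensional (pts S)"
  by (simp add: cont_short_def PiE_def)

lemma cont_short_mem: "\<phi> \<in> cont_short S T \<Longrightarrow> x \<in> pts S \<Longrightarrow> \<phi> x \<in> pts T"
  by (auto simp: cont_short_def)

lemma cont_short_compose:
  assumes "\<phi> \<in> cont_short S T" "\<psi> \<in> cont_short T R"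
  shows "compose (pts S) \<psi> \<phi> \<in> cont_short S R"
proof -
  have "continuous_map (Top S) (Top R) (\<psi> \<circ> \<phi>)"
    using assms unfolding cont_short_def by (blast intro: continuous_map_compose)
  then have "continuous_map (Top S) (Top R) (compose (pts S) \<psi> \<phi>)"
    by (rule continuous_map_eq) (simp add: compose_eq)
  moreover have "Dst R (\<psi> (\<phi> x)) (\<psi> (\<phi> y)) \<le> Dst S x y"
    if "x \<in> pts S" "y \<in> pts S" for x y
  proof -
    have "\<phi> x \<in> pts T" "\<phi> y \<in> pts T"
      using assms(1) that by (auto simp: cont_short_def)
    then have "Dst R (\<psi> (\<phi> x)) (\<psi> (\<phi> y)) \<le> Dst T (\<phi> x) (\<phi> y)"
      using assms(2) by (simp add: cont_short_def)
    also have "\<dots> \<le> Dst S x y"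
      using assms(1) that by (simp add: cont_short_def)
    finally show ?thesis .
  qed
  ultimately show ?thesis
    using assms by (auto simp: cont_short_def compose_def)
qed

text \<open>The projection is onto, so maps out of the quotient can be cancelled against it;
  extensionality takes care of the points outside.\<close>

lemma cont_short_emt_obj_eqI:
  assumes "\<psi> \<in> cont_short (emt_obj \<kappa> S) T" "\<psi>' \<in> cont_short (emt_obj \<kappa> S) T"
    and eq: "compose (pts S) \<psi> (emt_proj \<kappa> S) = compose (pts S) \<psi>' (emt_proj \<kappa> S)"
  shows "\<psi> = \<psi>'"
proof (rule PiE_ext)
  show "\<psi> \<in> emt_pts \<kappa> S \<rightarrow>\<^sub>E pts T" "\<psi>' \<in> emt_pts \<kappa> S \<rightarrow>\<^sub>E pts T"
    using assms by (auto simp: cont_short_def)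
  fix a assume "a \<in> emt_pts \<kappa> S"
  then obtain x where "x \<in> pts S" "a = emt_proj \<kappa> S x"
    unfolding emt_proj_image[symmetric] by blast
  then show "\<psi> a = \<psi>' a"
    using fun_cong[OF eq, of x] by (simp add: compose_def)
qed

text \<open>Since the distance of \<open>T\<close> is the supremum over its test functions,
  \<open>\<phi>\<close> is short even for \<open>LIP_sup\<close> on \<open>S\<close>. It therefore
  sends equivalent points to points at distance 0, which coincide in \<open>T\<close>, and the
  induced map is short.\<close>

lemma emt_universal:
  assumes \<kappa>: "class_coding \<kappa>" and T: "emt_space T" and \<phi>: "\<phi> \<in> cont_short S T"
  obtains \<psi> where "\<psi> \<in> cont_short (emt_obj \<kappa> S) T" "compose (pts S) \<psi> (emt_proj \<kappa> S) = \<phi>"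
proof
  let ?p = "emt_proj \<kappa> S"
  define \<psi> where "\<psi> = (\<lambda>a\<in>emt_pts \<kappa> S. \<phi> (SOME x. x \<in> pts S \<and> ?p x = a))"
  have \<phi>_mem: "\<phi> x \<in> pts T" if "x \<in> pts S" for x
    using \<phi> that by (rule cont_short_mem)
  have le: "Dst T (\<phi> x) (\<phi> y) \<le> LIP_sup (Top S) (Dst S) x y"
    if "x \<in> pts S" "y \<in> pts S" for x y
  proof -
    have "Dst T (\<phi> x) (\<phi> y) = LIP_sup (Top T) (Dst T) (\<phi> x) (\<phi> y)"
      using T that \<phi>_mem by (simp add: emt_space_def)
    also have "\<dots> \<le> LIP_sup (Top S) (Dst S) x y"
      using \<phi> by (intro LIP_sup_contract) (auto simp: cont_short_def)
    finally show ?thesis .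
  qed
  have eq: "\<psi> (?p x) = \<phi> x" if x: "x \<in> pts S" for x
  proof -
    let ?y = "SOME y. y \<in> pts S \<and> ?p y = ?p x"
    have y: "?y \<in> pts S \<and> ?p ?y = ?p x"
      by (rule someI[of _ x]) (simp add: x)
    then have "LIP_sup (Top S) (Dst S) ?y x = 0"
      using x emt_proj_eq_iff[OF \<kappa>] by blast
    then have "Dst T (\<phi> ?y) (\<phi> x) = 0"
      using le[of ?y x] x y by simp
    then have "\<phi> ?y = \<phi> x"
      using T \<phi>_mem x y by (simp add: emt_space_def extended_distance_def)
    then show ?thesis
      using x by (simp add: \<psi>_def emt_proj_mem)
  qed
  show "compose (pts S) \<psi> ?p = \<phi>"
    using cont_short_extensional[OF \<phi>]
    by (rule extensionalityI[OF compose_extensional]) (simp add: compose_eq eq)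
  have ball: "(\<forall>a\<in>emt_pts \<kappa> S. P a) \<longleftrightarrow> (\<forall>x\<in>pts S. P (?p x))" for P
    unfolding emt_proj_image[symmetric] by blast
  have \<psi>_mem: "\<forall>a\<in>emt_pts \<kappa> S. \<psi> a \<in> pts T"
    unfolding ball by (simp add: eq \<phi>_mem)
  have \<psi>_short: "\<forall>a\<in>emt_pts \<kappa> S. \<forall>b\<in>emt_pts \<kappa> S. Dst T (\<psi> a) (\<psi> b) \<le> emt_dist \<kappa> S a b"
    unfolding ball by (simp add: eq le emt_dist_proj[OF \<kappa>])
  \<comment> \<open>As \<open>T\<close> carries the initial topology, it is enough to treat
    \<open>f \<circ> \<psi>\<close>. Its pullback along the projection agrees on
    \<open>pts S\<close> with the test function \<open>f \<circ> \<phi>\<close>, so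
    \<open>f \<circ> \<psi>\<close> is itself a test function of the quotient.\<close>
  have "continuous_map (Top (emt_obj \<kappa> S)) euclideanreal (f \<circ> \<psi>)"
    if f: "f \<in> LIP_b1 (Top T) (Dst T)" for f
  proof -
    have "f \<circ> \<phi> \<in> LIP_b1 (Top S) (Dst S)"
      using \<phi> by (intro LIP_b1_compose[OF f]) (auto simp: cont_short_def)
    moreover have "continuous_map (Top S) euclideanreal (f \<circ> \<psi> \<circ> ?p)"
      if "continuous_map (Top S) euclideanreal (f \<circ> \<phi>)"
      using that by (rule continuous_map_eq) (simp add: eq)
    ultimately have "f \<circ> \<psi> \<circ> ?p \<in> LIP_b1 (Top S) (Dst S)"
      by (auto simp: LIP_b1_def eq cong: image_cong)
    then have "f \<circ> \<psi> \<in> LIP_b1 (Top (emt_obj \<kappa> S)) (emt_dist \<kappa> S)"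
      by (simp add: LIP_b1_emt_obj LIP_b1_emt_qtop_iff[OF \<kappa>])
    then show ?thesis
      by (simp add: LIP_b1_def)
  qed
  moreover have "Top T = initial_topology (pts T) (LIP_b1 (Top T) (Dst T))"
    using T by (simp add: emt_space_def)
  ultimately have "continuous_map (Top (emt_obj \<kappa> S)) (Top T) \<psi>"
    using \<psi>_mem by (metis Pi_I continuous_map_into_initial_topology pts_emt_obj)
  then show "\<psi> \<in> cont_short (emt_obj \<kappa> S) T"
    using \<psi>_mem \<psi>_short by (auto simp: cont_short_def) (simp add: \<psi>_def)
qed

section \<open>Action on morphisms\<close>

lemma
  assumes \<kappa>: "class_coding \<kappa>" and \<phi>: "\<phi> \<in> cont_short S T"
  shows emt_mor_cont_short: "emt_mor \<kappa> S T \<phi> \<in> cont_short (emt_obj \<kappa> S) (emt_obj \<kappa> T)"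
    and emt_mor_proj: "compose (pts S) (emt_mor \<kappa> S T \<phi>) (emt_proj \<kappa> S) =
      compose (pts S) (emt_proj \<kappa> T) \<phi>"
proof -
  let ?P = "\<lambda>\<psi>. \<psi> \<in> cont_short (emt_obj \<kappa> S) (emt_obj \<kappa> T) \<and>
    compose (pts S) \<psi> (emt_proj \<kappa> S) = compose (pts S) (emt_proj \<kappa> T) \<phi>"
  \<comment> \<open>The universal property is applied to \<open>\<phi>\<close> followed by the
    projection of \<open>T\<close>; the target \<open>emt_obj \<kappa> T\<close> is an e.m.t.
    space.\<close>
  obtain \<psi> where "?P \<psi>"
    using emt_universal[OF \<kappa> emt_space_emt_obj[OF \<kappa>]
        cont_short_compose[OF \<phi> emt_proj_cont_short[OF \<kappa>]]] by blast
  then have "\<exists>!\<psi>. ?P \<psi>"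
    by (auto intro: cont_short_emt_obj_eqI)
  from theI'[OF this]
  show "emt_mor \<kappa> S T \<phi> \<in> cont_short (emt_obj \<kappa> S) (emt_obj \<kappa> T)"
    and "compose (pts S) (emt_mor \<kappa> S T \<phi>) (emt_proj \<kappa> S) = compose (pts S) (emt_proj \<kappa> T) \<phi>"
    unfolding emt_mor_def by blast+
qed

text \<open>Both functor laws follow from this: it is enough to check that the candidate completes
  the square with the projections.\<close>

lemma emt_mor_eqI:
  assumes \<kappa>: "class_coding \<kappa>" and \<phi>: "\<phi> \<in> cont_short S T"
    and \<psi>: "\<psi> \<in> cont_short (emt_obj \<kappa> S) (emt_obj \<kappa> T)"
    and eq: "compose (pts S) \<psi> (emt_proj \<kappa> S) = compose (pts S) (emt_proj \<kappa> T) \<phi>"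
  shows "emt_mor \<kappa> S T \<phi> = \<psi>"
  by (rule cont_short_emt_obj_eqI[OF emt_mor_cont_short[OF \<kappa> \<phi>] \<psi>])
    (simp only: eq emt_mor_proj[OF \<kappa> \<phi>])

section \<open>The adjunction\<close>

lemma cont_short_ident: "(\<lambda>x\<in>pts S. x) \<in> cont_short S S"
proof -
  have "continuous_map (Top S) (Top S) (\<lambda>x\<in>pts S. x)"
    by (rule continuous_map_eq[of _ _ "\<lambda>x. x"]) auto
  then show ?thesis by (auto simp: cont_short_def)
qed

text \<open>The inner composite on the right is restricted to \<open>pts T\<close>, so
  \<open>\<phi>\<close> has to map into that set. Nothing is asked of \<open>\<psi>\<close> and
  \<open>\<theta>\<close>, so the equation can be used for rewriting without typing them.\<close>

lemma cont_short_compose_assoc: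
  assumes "\<phi> \<in> cont_short S T"
  shows "compose (pts S) \<theta> (compose (pts S) \<psi> \<phi>) = compose (pts S) (compose (pts T) \<theta> \<psi>) \<phi>"
  by (rule extensionalityI[OF compose_extensional compose_extensional])
    (simp add: compose_eq cont_short_mem[OF assms])

lemma cont_short_compose_ident:
  assumes "\<phi> \<in> cont_short S T"
  shows "compose (pts S) \<phi> (\<lambda>x\<in>pts S. x) = \<phi>" "compose (pts S) (\<lambda>x\<in>pts T. x) \<phi> = \<phi>"
  by (rule extensionalityI[OF compose_extensional cont_short_extensional[OF assms]],
      simp add: compose_eq cont_short_mem[OF assms])+

section \<open>The two categories and the functors between them\<close>

lemma PreExtPsiMetTop_simps [simp]:
  "Obj PreExtPsiMetTop = {S. pre_epmt_space S}"
  "Hom PreExtPsiMetTop = cont_short"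
  "Idn PreExtPsiMetTop = (\<lambda>S. \<lambda>x\<in>pts S. x)"
  "Cmp PreExtPsiMetTop = (\<lambda>S T R \<psi> \<phi>. compose (pts S) \<psi> \<phi>)"
  by (simp_all add: PreExtPsiMetTop_def)

lemma ExtMetTop_simps [simp]:
  "Obj ExtMetTop = {S. emt_space S}"
  "Hom ExtMetTop = cont_short"
  "Idn ExtMetTop = (\<lambda>S. \<lambda>x\<in>pts S. x)"
  "Cmp ExtMetTop = (\<lambda>S T R \<psi> \<phi>. compose (pts S) \<psi> \<phi>)"
  by (auto simp: ExtMetTop_def full_subcategory_def emt_space_def)

lemma category_PreExtPsiMetTop: "category PreExtPsiMetTop"
  unfolding category_def
  by (auto simp: cont_short_ident cont_short_compose cont_short_compose_ident
      intro: cont_short_compose_assoc)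

lemma category_ExtMetTop: "category ExtMetTop"
  unfolding category_def
  by (auto simp: cont_short_ident cont_short_compose cont_short_compose_ident
      intro: cont_short_compose_assoc)

lemma is_functor_incl: "is_functor ExtMetTop PreExtPsiMetTop incl"
  unfolding is_functor_def
  by (auto simp: category_PreExtPsiMetTop category_ExtMetTop incl_def emt_space_def)

lemma emt_mor_ident:
  assumes \<kappa>: "class_coding \<kappa>"
  shows "emt_mor \<kappa> S S (\<lambda>x\<in>pts S. x) = (\<lambda>a\<in>emt_pts \<kappa> S. a)"
  using cont_short_ident[of "emt_obj \<kappa> S"] cont_short_compose_ident[OF emt_proj_cont_short[OF \<kappa>, of S]]
  by (intro emt_mor_eqI[OF \<kappa> cont_short_ident]) simp_all

text \<open>Pasting the commuting squares of \<open>\<phi>\<close> and \<open>\<psi>\<close> gives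
  the square that characterises the image of their composite.\<close>

lemma emt_mor_compose:
  assumes \<kappa>: "class_coding \<kappa>" and \<phi>: "\<phi> \<in> cont_short S T" and \<psi>: "\<psi> \<in> cont_short T R"
  shows "emt_mor \<kappa> S R (compose (pts S) \<psi> \<phi>) =
    compose (emt_pts \<kappa> S) (emt_mor \<kappa> T R \<psi>) (emt_mor \<kappa> S T \<phi>)"
proof (rule emt_mor_eqI[OF \<kappa> cont_short_compose[OF \<phi> \<psi>]])
  let ?\<phi> = "emt_mor \<kappa> S T \<phi>" and ?\<psi> = "emt_mor \<kappa> T R \<psi>"
  show "compose (emt_pts \<kappa> S) ?\<psi> ?\<phi> \<in> cont_short (emt_obj \<kappa> S) (emt_obj \<kappa> R)"
    using cont_short_compose[OF emt_mor_cont_short[OF \<kappa> \<phi>] emt_mor_cont_short[OF \<kappa> \<psi>]] by simp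
  have "compose (pts S) (compose (emt_pts \<kappa> S) ?\<psi> ?\<phi>) (emt_proj \<kappa> S) =
      compose (pts S) ?\<psi> (compose (pts S) ?\<phi> (emt_proj \<kappa> S))"
    by (rule cont_short_compose_assoc[OF emt_proj_cont_short[OF \<kappa>], unfolded pts_emt_obj, symmetric])
  also have "\<dots> = compose (pts S) ?\<psi> (compose (pts S) (emt_proj \<kappa> T) \<phi>)"
    by (simp only: emt_mor_proj[OF \<kappa> \<phi>])
  also have "\<dots> = compose (pts S) (compose (pts T) ?\<psi> (emt_proj \<kappa> T)) \<phi>"
    by (rule cont_short_compose_assoc[OF \<phi>])
  also have "\<dots> = compose (pts S) (compose (pts T) (emt_proj \<kappa> R) \<psi>) \<phi>"
    by (simp only: emt_mor_proj[OF \<kappa> \<psi>])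
  also have "\<dots> = compose (pts S) (emt_proj \<kappa> R) (compose (pts S) \<psi> \<phi>)"
    by (rule cont_short_compose_assoc[OF \<phi>, symmetric])
  finally show "compose (pts S) (compose (emt_pts \<kappa> S) ?\<psi> ?\<phi>) (emt_proj \<kappa> S) =
    compose (pts S) (emt_proj \<kappa> R) (compose (pts S) \<psi> \<phi>)" .
qed

lemma is_functor_emt:
  assumes "class_coding \<kappa>"
  shows "is_functor PreExtPsiMetTop ExtMetTop (emt \<kappa>)"
  using assms unfolding is_functor_def
  by (auto simp: category_PreExtPsiMetTop category_ExtMetTop emt_def emt_space_emt_obj
      emt_mor_cont_short emt_mor_ident emt_mor_compose)

lemma is_functor_comp:
  assumes "is_functor C D F" "is_functor D E G"
  shows "is_functor C E (G \<circ>\<^sub>F F)"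
  using assms unfolding is_functor_def comp_functor_def by auto

lemma is_functor_id: "category C \<Longrightarrow> is_functor C C id_functor"
  unfolding is_functor_def id_functor_def category_def by auto

section \<open>Adjunction, reflectivity and the unit\<close>

lemma left_adjoint_emt:
  assumes \<kappa>: "class_coding \<kappa>"
  shows "left_adjoint ExtMetTop PreExtPsiMetTop (emt \<kappa>) incl"
proof -
  \<comment> \<open>The hom-set bijection is precomposition with the projection, which is the unit.
    Injectivity and surjectivity are the uniqueness and existence halves of the universal
    property.\<close>
  let ?\<Phi> = "\<lambda>S T \<psi>. compose (pts S) \<psi> (emt_proj \<kappa> S)"
  have bij: "bij_betw (?\<Phi> S T) (cont_short (emt_obj \<kappa> S) T) (cont_short S T)"
    if "emt_space T" for S T
  proof (rule bij_betwI')
    show "?\<Phi> S T \<psi> = ?\<Phi> S T \<psi>' \<longleftrightarrow> \<psi> = \<psi>'"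
      if "\<psi> \<in> cont_short (emt_obj \<kappa> S) T" "\<psi>' \<in> cont_short (emt_obj \<kappa> S) T" for \<psi> \<psi>'
      using that cont_short_emt_obj_eqI by blast
    show "?\<Phi> S T \<psi> \<in> cont_short S T" if "\<psi> \<in> cont_short (emt_obj \<kappa> S) T" for \<psi>
      using emt_proj_cont_short[OF \<kappa>] that by (rule cont_short_compose)
    show "\<exists>\<psi>\<in>cont_short (emt_obj \<kappa> S) T. \<phi> = ?\<Phi> S T \<psi>" if "\<phi> \<in> cont_short S T" for \<phi>
      using emt_universal[OF \<kappa> \<open>emt_space T\<close> that] by blast
  qed
  have nat: "?\<Phi> S' T' (compose (emt_pts \<kappa> S') \<theta> (compose (emt_pts \<kappa> S') \<psi> (emt_mor \<kappa> S' S \<phi>))) =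
      compose (pts S') \<theta> (compose (pts S') (?\<Phi> S T \<psi>) \<phi>)"
    if \<phi>: "\<phi> \<in> cont_short S' S" for S S' T T' \<phi> \<psi> \<theta>
  proof -
    note assoc = cont_short_compose_assoc[OF emt_proj_cont_short[OF \<kappa>, of S'], unfolded pts_emt_obj,
        symmetric]
    show ?thesis
      \<comment> \<open>Both sides are bracketed to the right; they then differ only by the square
        relating \<open>emt_mor\<close> to the projections.\<close>
      by (simp only: assoc emt_mor_proj[OF \<kappa> \<phi>] cont_short_compose_assoc[OF \<phi>, symmetric])
  qed
  show ?thesis
    unfolding left_adjoint_def
  proof (intro conjI exI)
    show "is_functor PreExtPsiMetTop ExtMetTop (emt \<kappa>)"
      using \<kappa> by (rule is_functor_emt)
    show "is_functor ExtMetTop PreExtPsiMetTop incl"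
      by (rule is_functor_incl)
    show "\<forall>S\<in>Obj PreExtPsiMetTop. \<forall>T\<in>Obj ExtMetTop. bij_betw (?\<Phi> S T)
        (Hom ExtMetTop (FObj (emt \<kappa>) S) T) (Hom PreExtPsiMetTop S (FObj incl T))"
      by (simp add: bij emt_def incl_def)
  qed (simp add: emt_def incl_def nat)
qed

text \<open>The inclusion is the identity on hom-sets, and both categories use the same
  \<open>cont_short\<close>.\<close>

lemma fully_faithful_incl: "fully_faithful ExtMetTop PreExtPsiMetTop incl"
  by (simp add: fully_faithful_def incl_def bij_betw_def)

text \<open>The naturality square of the projections is the equation by which \<open>emt_mor\<close>
  is defined.\<close>

lemma natural_transformation_emt_proj:
  assumes "class_coding \<kappa>"
  shows "natural_transformation PreExtPsiMetTop PreExtPsiMetTop id_functor (incl \<circ>\<^sub>F emt \<kappa>)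
    (emt_proj \<kappa>)"
  unfolding natural_transformation_def
  using is_functor_id[OF category_PreExtPsiMetTop]
    is_functor_comp[OF is_functor_emt[OF assms] is_functor_incl]
  by (simp add: id_functor_def comp_functor_def incl_def emt_def emt_proj_cont_short[OF assms]
      emt_mor_proj[OF assms])

theorem theorem3p10:
  fixes \<kappa> :: "'u set \<Rightarrow> 'u"
  assumes "class_coding \<kappa>"
  shows "left_adjoint (ExtMetTop :: ('u space, 'u \<Rightarrow> 'u) cat) PreExtPsiMetTop (emt \<kappa>) incl
    \<and> exhibits_reflective (ExtMetTop :: ('u space, 'u \<Rightarrow> 'u) cat) PreExtPsiMetTop incl (emt \<kappa>)
    \<and> natural_transformation (PreExtPsiMetTop :: ('u space, 'u \<Rightarrow> 'u) cat) PreExtPsiMetTop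
        id_functor (incl \<circ>\<^sub>F emt \<kappa>) (emt_proj \<kappa>)"
  unfolding exhibits_reflective_def
  using left_adjoint_emt[OF assms] is_functor_incl fully_faithful_incl
    natural_transformation_emt_proj[OF assms] by blast

end
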